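(* Assume $\rho=1$ and that there exist $\mu_i>0$, $i\in\mathcal I$, such that $\mu_{ij}=\mu_i$ for all $(ij)\in\mathcal E$. Then the system is locally stable (i.e., $A_c$ is stable).
   Context: Model. Customer types $i\in\mathcal I$, $|\mathcal I|=I$; server pools $j\in\mathcal J$, $|\mathcal J|=J$ (finite). Parameters: $\lambda_i>0$, $\beta_j>0$, $\mu_{ij}\ge 0$ ($\mu_{ij}=0$ means pool $j$ cannot serve type $i$). Static planning problem (SPP): minimize $\rho$ over $(\lambda_{ij}),\rho$ subject to $\lambda_{ij}\ge0$, $\sum_j\lambda_{ij}=\lambda_i$ for all $i$, and $\sum_i\lambda_{ij}/(\beta_j\mu_{ij})\le\rho$ for all $j$. Standing assumption (complete resource pooling): the SPP has a unique optimal solution $(\lambda_{ij}),\rho$, and the set of basic activities $\mathcal E=\{(ij):\lambda_{ij}>0\}$ is the edge set of a (connected) tree on the vertex set $\mathcal I\cup\mathcal J$. $\mathcal S(i)=\{j:(ij)\in\mathcal E\}$, $\mathcal C(j)=\{i:(ij)\in\mathcal E\}$. Matrices. For $y\in\mathbb R^I$ let $z=My\in\mathbb R^{\mathcal E}$ be the unique solution of $\sum_{i\in\mathcal C(j)}z_{ij}=\eta\beta_j$ for all $j$ and $\sum_{j\in\mathcal S(i)}z_{ij}=y_i$ for all $i$, where $\eta=\sum_iy_i/\sum_j\beta_j$. $A_u$ is the $I\times I$ matrix of the linear map $y\mapsto\big(-\sum_{j\in\mathcal S(i)}\mu_{ij}(My)_{ij}\big)_{i}$, and $A_c$ is the $I\times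 I$ matrix with entries $(A_c)_{ii'}=(A_u)_{ii'}-\frac1I\sum_k(A_u)_{ki'}$; it governs, through $(\dot\psi_i)=(\lambda_i-\frac1I\sum_k\lambda_k)+A_c(\psi_i)$, the critically loaded ($\rho=1$) fluid model near an equilibrium point with equal positive queues. $A_c$ is stable if all its eigenvalues have negative real part except one simple eigenvalue $0$; local stability of the critically loaded system is understood as stability of $A_c$. *)

theory Defs
  imports Complex_Main "Jordan_Normal_Form.Char_Poly"
begin

text \<open>
  Customer types are \<open>{..<I}\<close> and server pools are \<open>{..<J}\<close>; vectors and matrices indexed by
  them are those of \<^theory>\<open>Jordan_Normal_Form.Matrix\<close>.
\<close>

definition model_parameters ::
  "nat \<Rightarrow> nat \<Rightarrow> real vec \<Rightarrow> real vec \<Rightarrow> real mat \<Rightarrow> bool" where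
  "model_parameters I J lam bet mu \<longleftrightarrow>
     1 \<le> I \<and> 1 \<le> J \<and>
     lam \<in> carrier_vec I \<and> bet \<in> carrier_vec J \<and> mu \<in> carrier_mat I J \<and>
     (\<forall>i<I. 0 < lam $ i) \<and> (\<forall>j<J. 0 < bet $ j) \<and>
     (\<forall>i<I. \<forall>j<J. 0 \<le> mu $$ (i, j))"

text \<open>
  A pool with \<open>mu $$ (i, j) = 0\<close> cannot serve type \<open>i\<close>, so the load \<open>x $$ (i, j)\<close> must vanish
  there. This has to be required explicitly, because \<open>x / 0 = 0\<close> in HOL would make such a
  routing free of charge; with the requirement, the corresponding summands are \<open>0 / 0 = 0\<close>.
\<close>

definition spp_feasible ::
  "nat \<Rightarrow> nat \<Rightarrow> real vec \<Rightarrow> real vec \<Rightarrow> real mat \<Rightarrow> real mat \<Rightarrow> real \<Rightarrow> bool" where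
  "spp_feasible I J lam bet mu x rho \<longleftrightarrow>
     x \<in> carrier_mat I J \<and>
     (\<forall>i<I. \<forall>j<J. 0 \<le> x $$ (i, j)) \<and>
     (\<forall>i<I. \<forall>j<J. mu $$ (i, j) = 0 \<longrightarrow> x $$ (i, j) = 0) \<and>
     (\<forall>i<I. (\<Sum>j<J. x $$ (i, j)) = lam $ i) \<and>
     (\<forall>j<J. (\<Sum>i<I. x $$ (i, j) / (bet $ j * mu $$ (i, j))) \<le> rho)"

definition spp_optimal ::
  "nat \<Rightarrow> nat \<Rightarrow> real vec \<Rightarrow> real vec \<Rightarrow> real mat \<Rightarrow> real mat \<Rightarrow> real \<Rightarrow> bool" where
  "spp_optimal I J lam bet mu x rho \<longleftrightarrow>
     spp_feasible I J lam bet mu x rho \<and>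
     (\<forall>x' rho'. spp_feasible I J lam bet mu x' rho' \<longrightarrow> rho \<le> rho')"

definition basic_activities :: "real mat \<Rightarrow> (nat \<times> nat) set" where
  "basic_activities x = {(i, j). i < dim_row x \<and> j < dim_col x \<and> 0 < x $$ (i, j)}"

text \<open>
  Undirected simple graphs with vertex set \<open>V\<close> and a set \<open>F\<close> of two-element edges. (The predicate
  \<open>tree\<close> of the AFP entry Graph-Theory excludes only directed cycles, hence is not the
  undirected notion.)
\<close>

definition is_cycle :: "'v set set \<Rightarrow> 'v list \<Rightarrow> bool" where
  "is_cycle F vs \<longleftrightarrow>
     3 \<le> length vs \<and> distinct vs \<and>
     (\<forall>k<length vs. {vs ! k, vs ! (Suc k mod length vs)} \<in> F)"

definition is_tree :: "'v set \<Rightarrow> 'v set set \<Rightarrow> bool" where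
  "is_tree V F \<longleftrightarrow>
     V \<noteq> {} \<and>
     (\<forall>e\<in>F. e \<subseteq> V \<and> card e = 2) \<and>
     (\<forall>u\<in>V. \<forall>v\<in>V. (u, v) \<in> {(a, b). {a, b} \<in> F}\<^sup>*) \<and>
     (\<nexists>vs. is_cycle F vs)"

definition activity_vertices :: "nat \<Rightarrow> nat \<Rightarrow> (nat + nat) set" where
  "activity_vertices I J = Inl ` {..<I} \<union> Inr ` {..<J}"

definition activity_edges :: "(nat \<times> nat) set \<Rightarrow> (nat + nat) set set" where
  "activity_edges E = {{Inl i, Inr j} | i j. (i, j) \<in> E}"

definition complete_resource_pooling ::
  "nat \<Rightarrow> nat \<Rightarrow> real vec \<Rightarrow> real vec \<Rightarrow> real mat \<Rightarrow> real mat \<Rightarrow> real \<Rightarrow> bool" where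
  "complete_resource_pooling I J lam bet mu x rho \<longleftrightarrow>
     spp_optimal I J lam bet mu x rho \<and>
     (\<forall>x' rho'. spp_optimal I J lam bet mu x' rho' \<longrightarrow> x' = x \<and> rho' = rho) \<and>
     is_tree (activity_vertices I J) (activity_edges (basic_activities x))"

definition pools_of :: "(nat \<times> nat) set \<Rightarrow> nat \<Rightarrow> nat set" where
  "pools_of E i = {j. (i, j) \<in> E}"

definition types_of :: "(nat \<times> nat) set \<Rightarrow> nat \<Rightarrow> nat set" where
  "types_of E j = {i. (i, j) \<in> E}"

text \<open>
  The map \<open>M\<close>. An element of \<open>\<real>\<^sup>E\<close> is encoded as an \<open>I \<times> J\<close> matrix vanishing off \<open>E\<close>, which
  makes the solution unique also as a matrix. Uniqueness and existence hold whenever \<open>E\<close> is the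
  edge set of a tree.
\<close>

definition M_map ::
  "nat \<Rightarrow> nat \<Rightarrow> real vec \<Rightarrow> (nat \<times> nat) set \<Rightarrow> real vec \<Rightarrow> real mat" where
  "M_map I J bet E y = (THE z.
     z \<in> carrier_mat I J \<and>
     (\<forall>i<I. \<forall>j<J. (i, j) \<notin> E \<longrightarrow> z $$ (i, j) = 0) \<and>
     (\<forall>j<J. (\<Sum>i\<in>types_of E j. z $$ (i, j)) = (\<Sum>i<I. y $ i) / (\<Sum>j<J. bet $ j) * bet $ j) \<and>
     (\<forall>i<I. (\<Sum>j\<in>pools_of E i. z $$ (i, j)) = y $ i))"

definition A_u_map ::
  "nat \<Rightarrow> nat \<Rightarrow> real vec \<Rightarrow> real mat \<Rightarrow> (nat \<times> nat) set \<Rightarrow> real vec \<Rightarrow> real vec" where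
  "A_u_map I J bet mu E y =
     vec I (\<lambda>i. - (\<Sum>j\<in>pools_of E i. mu $$ (i, j) * M_map I J bet E y $$ (i, j)))"

definition A_u :: "nat \<Rightarrow> nat \<Rightarrow> real vec \<Rightarrow> real mat \<Rightarrow> (nat \<times> nat) set \<Rightarrow> real mat" where
  "A_u I J bet mu E = mat I I (\<lambda>(i, i'). A_u_map I J bet mu E (unit_vec I i') $ i)"

definition A_c :: "nat \<Rightarrow> nat \<Rightarrow> real vec \<Rightarrow> real mat \<Rightarrow> (nat \<times> nat) set \<Rightarrow> real mat" where
  "A_c I J bet mu E = mat I I (\<lambda>(i, i').
     A_u I J bet mu E $$ (i, i') - 1 / real I * (\<Sum>k<I. A_u I J bet mu E $$ (k, i')))"

text \<open>
  Stability in the critically loaded case. Eigenvalues are complex, and a simple eigenvalue is one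
  of algebraic multiplicity one.
\<close>

definition critically_stable :: "real mat \<Rightarrow> bool" where
  "critically_stable A \<longleftrightarrow>
     (let B = map_mat complex_of_real A in
        eigenvalue B 0 \<and> order 0 (char_poly B) = 1 \<and>
        (\<forall>z. eigenvalue B z \<and> z \<noteq> 0 \<longrightarrow> Re z < 0))"

end

theory Submission
  imports Defs
begin

text \<open>
  If \<open>mu\<close> depends only on the customer type on basic activities, then the row equations for
  \<open>M y\<close> give \<open>A_u = - D\<close> with \<open>D = diag m\<close>, as soon as \<open>M\<close> is well defined. Existence of \<open>M y\<close>
  follows from connectedness by routing along paths with alternating signs. Uniqueness follows
  from that of the SPP solution: if \<open>z\<close> has zero row and column sums, then \<open>x + \<epsilon> D z\<close> is again
  optimal for small \<open>\<epsilon>\<close>.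

  Hence \<open>A_c = - P D\<close>, where \<open>P\<close> is the orthogonal projection onto the vectors of zero sum. An
  eigenvector \<open>v\<close> for an eigenvalue \<open>z \<noteq> 0\<close> has zero sum, and pairing the eigenvalue equation with
  the conjugate of \<open>v\<close> gives \<open>z \<Sum>|v\<^sub>i|\<^sup>2 = - \<Sum> m\<^sub>i |v\<^sub>i|\<^sup>2\<close>. The kernel is spanned by the
  vector \<open>(1 / m\<^sub>i)\<^sub>i\<close>, whose sum is not zero, and therefore \<open>0\<close> is simple.
\<close>

section \<open>Prescribed row and column sums on a connected bipartite graph\<close>

text \<open>The image of the vertex-edge incidence map of \<open>E\<close>. Row and column targets
  are joined into one function \<open>b\<close> on vertices, so that paths through both sides can be
  treated uniformly.\<close>

definition sums_solvable ::
  "nat \<Rightarrow> nat \<Rightarrow> (nat \<times> nat) set \<Rightarrow> (nat + nat \<Rightarrow> real) \<Rightarrow> bool" where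
  "sums_solvable I J E b \<longleftrightarrow> (\<exists>z :: nat \<Rightarrow> nat \<Rightarrow> real.
     (\<forall>i j. (i, j) \<notin> E \<longrightarrow> z i j = 0) \<and>
     (\<forall>i<I. (\<Sum>j<J. z i j) = b (Inl i)) \<and> (\<forall>j<J. (\<Sum>i<I. z i j) = b (Inr j)))"

text \<open>The bipartition as signs: pairing \<open>b\<close> with \<open>side_sign\<close> gives
  row total minus column total, a functional that vanishes on the incidence vector of every
  edge.\<close>

definition side_sign :: "nat + nat \<Rightarrow> real" where
  "side_sign v = (case v of Inl _ \<Rightarrow> 1 | Inr _ \<Rightarrow> - 1)"

lemma side_sign_simps [simp]:
  "side_sign (Inl i) = 1" "side_sign (Inr j) = - 1" "side_sign v * side_sign v = 1"
  by (auto simp: side_sign_def split: sum.splits)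

lemma sums_solvable_zero: "sums_solvable I J E (\<lambda>_. 0)"
  unfolding sums_solvable_def by (rule exI[of _ "\<lambda>_ _. 0"]) simp

lemma sums_solvable_add:
  assumes "sums_solvable I J E b" "sums_solvable I J E c"
  shows "sums_solvable I J E (\<lambda>v. b v + c v)"
proof -
  obtain z where z: "\<forall>i j. (i, j) \<notin> E \<longrightarrow> z i j = 0"
    "\<forall>i<I. (\<Sum>j<J. z i j) = b (Inl i)" "\<forall>j<J. (\<Sum>i<I. z i j) = b (Inr j)"
    using assms(1) unfolding sums_solvable_def by blast
  obtain w where w: "\<forall>i j. (i, j) \<notin> E \<longrightarrow> w i j = 0"
    "\<forall>i<I. (\<Sum>j<J. w i j) = c (Inl i)" "\<forall>j<J. (\<Sum>i<I. w i j) = c (Inr j)"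
    using assms(2) unfolding sums_solvable_def by blast
  show ?thesis
    unfolding sums_solvable_def
    by (rule exI[of _ "\<lambda>i j. z i j + w i j"]) (simp add: z w sum.distrib)
qed

lemma sums_solvable_scale:
  assumes "sums_solvable I J E b"
  shows "sums_solvable I J E (\<lambda>v. a * b v)"
proof -
  obtain z where z: "\<forall>i j. (i, j) \<notin> E \<longrightarrow> z i j = 0"
    "\<forall>i<I. (\<Sum>j<J. z i j) = b (Inl i)" "\<forall>j<J. (\<Sum>i<I. z i j) = b (Inr j)"
    using assms unfolding sums_solvable_def by blast
  show ?thesis
    unfolding sums_solvable_def
    by (rule exI[of _ "\<lambda>i j. a * z i j"]) (simp add: z flip: sum_distrib_left)
qed

lemma sums_solvable_sum:
  assumes "finite S" "\<And>u. u \<in> S \<Longrightarrow> sums_solvable I J E (b u)"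
  shows "sums_solvable I J E (\<lambda>v. \<Sum>u\<in>S. b u v)"
  using assms
  by (induction S rule: finite_induct) (auto intro: sums_solvable_zero sums_solvable_add)

lemma sums_solvable_cong:
  assumes "sums_solvable I J E b" "\<And>v. v \<in> activity_vertices I J \<Longrightarrow> b v = c v"
  shows "sums_solvable I J E c"
proof -
  have "\<forall>i<I. b (Inl i) = c (Inl i)" "\<forall>j<J. b (Inr j) = c (Inr j)"
    using assms(2) unfolding activity_vertices_def by auto
  with assms(1) show ?thesis
    unfolding sums_solvable_def by metis
qed

lemma sums_solvable_edge:
  assumes E: "E \<subseteq> {..<I} \<times> {..<J}" and e: "(i, j) \<in> E"
  shows "sums_solvable I J E (\<lambda>v. if v = Inl i \<or> v = Inr j then 1 else 0)"
proof -
  have ij: "i < I" "j < J" using E e by auto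
  have row: "(\<Sum>l<J. if k = i \<and> l = j then 1 else 0) = (if k = i then 1 else (0::real))" for k
    using ij by (cases "k = i") auto
  have col: "(\<Sum>k<I. if k = i \<and> l = j then 1 else 0) = (if l = j then 1 else (0::real))" for l
    using ij by (cases "l = j") auto
  show ?thesis
    unfolding sums_solvable_def
    by (rule exI[of _ "\<lambda>k l. if k = i \<and> l = j then 1 else 0"]) (use e in \<open>auto simp: row col\<close>)
qed

text \<open>Alternating weights \<open>1\<close> and \<open>- 1\<close> along a path cancel at
  interior vertices. The sign of the next edge is determined by the side of the vertex it
  leaves.\<close>

lemma sums_solvable_path:
  assumes E: "E \<subseteq> {..<I} \<times> {..<J}"
    and "(u, w) \<in> {(a, b). {a, b} \<in> activity_edges E}\<^sup>*"
  shows "sums_solvable I J E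
    (\<lambda>v. (if v = u then side_sign u else 0) - (if v = w then side_sign w else 0))"
  using assms(2)
proof (induction rule: rtrancl_induct)
  case base
  show ?case using sums_solvable_zero by simp
next
  case (step w t)
  from step(2) obtain i j where ij: "{w, t} = {Inl i, Inr j}" "(i, j) \<in> E"
    unfolding activity_edges_def by auto
  from ij(1) have wt: "w = Inl i \<and> t = Inr j \<or> w = Inr j \<and> t = Inl i"
    by (auto simp: doubleton_eq_iff)
  show ?case
    \<comment> \<open>Weight \<open>side_sign w\<close> on the edge from \<open>w\<close> to
      \<open>t\<close> cancels the old endpoint term at \<open>w\<close> and leaves
      \<open>side_sign w = - side_sign t\<close> at \<open>t\<close>.\<close>
    by (rule sums_solvable_cong[OF sums_solvable_add[OF step.IH
          sums_solvable_scale[OF sums_solvable_edge[OF E ij(2)], of "side_sign w"]]])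
      (use wt in auto)
qed

text \<open>Each vertex \<open>u\<close> routes \<open>b u * side_sign u\<close> to the root
  \<open>r\<close>. At \<open>u\<close> the sign squares away and leaves \<open>b u\<close>; the
  surplus collected at \<open>r\<close> is the pairing of \<open>b\<close> with
  \<open>side_sign\<close>, which balance makes zero.\<close>

lemma sums_solvable_balanced:
  assumes E: "E \<subseteq> {..<I} \<times> {..<J}"
    and r: "r \<in> activity_vertices I J"
    and conn: "\<And>u. u \<in> activity_vertices I J \<Longrightarrow>
      (u, r) \<in> {(a, b). {a, b} \<in> activity_edges E}\<^sup>*"
    and balanced: "(\<Sum>i<I. b (Inl i)) = (\<Sum>j<J. b (Inr j))"
  shows "sums_solvable I J E b"
proof -
  let ?V = "activity_vertices I J"
  have fin: "finite ?V" unfolding activity_vertices_def by simp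
  have "(\<Sum>u\<in>?V. b u * side_sign u) = (\<Sum>i<I. b (Inl i)) - (\<Sum>j<J. b (Inr j))"
    unfolding activity_vertices_def
    by (subst sum.union_disjoint) (auto simp: sum.reindex sum_negf)
  then have zero: "(\<Sum>u\<in>?V. b u * side_sign u) = 0" using balanced by simp
  have "sums_solvable I J E (\<lambda>v. \<Sum>u\<in>?V. (b u * side_sign u) *
      ((if v = u then side_sign u else 0) - (if v = r then side_sign r else 0)))"
    by (intro sums_solvable_sum fin sums_solvable_scale sums_solvable_path E conn)
  then show ?thesis
  proof (rule sums_solvable_cong)
    fix v assume v: "v \<in> ?V"
    have "(\<Sum>u\<in>?V. (b u * side_sign u) *
        ((if v = u then side_sign u else 0) - (if v = r then side_sign r else 0)))
      = (\<Sum>u\<in>?V. if v = u then b u else 0)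
        - (\<Sum>u\<in>?V. b u * side_sign u) * (if v = r then side_sign r else 0)"
      unfolding sum_distrib_right sum_subtractf[symmetric]
      by (intro sum.cong refl) (simp add: algebra_simps)
    also have "\<dots> = b v" using v fin zero by simp
    finally show "(\<Sum>u\<in>?V. (b u * side_sign u) *
        ((if v = u then side_sign u else 0) - (if v = r then side_sign r else 0))) = b v" .
  qed
qed

section \<open>Well-definedness of \<open>M_map\<close> and the form of \<open>A_c\<close>\<close>

lemma sum_pools_of:
  assumes "E \<subseteq> {..<I} \<times> {..<J}" "\<forall>i<I. \<forall>j<J. (i, j) \<notin> E \<longrightarrow> f i j = (0::real)" "i < I"
  shows "(\<Sum>j\<in>pools_of E i. f i j) = (\<Sum>j<J. f i j)"
  by (rule sum.mono_neutral_left) (use assms in \<open>auto simp: pools_of_def\<close>)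

lemma sum_types_of:
  assumes "E \<subseteq> {..<I} \<times> {..<J}" "\<forall>i<I. \<forall>j<J. (i, j) \<notin> E \<longrightarrow> f i j = (0::real)" "j < J"
  shows "(\<Sum>i\<in>types_of E j. f i j) = (\<Sum>i<I. f i j)"
  by (rule sum.mono_neutral_left) (use assms in \<open>auto simp: types_of_def\<close>)

lemma ex_positive_perturbation:
  fixes x w :: "'a \<Rightarrow> real"
  assumes "finite S" "\<And>p. p \<in> S \<Longrightarrow> 0 < x p"
  shows "\<exists>e>0. \<forall>p\<in>S. 0 \<le> x p + e * w p"
  using assms
proof (induction S rule: finite_induct)
  case empty
  show ?case by (auto intro: exI[of _ 1])
next
  case (insert q S)
  then obtain e where e: "e > 0" "\<forall>p\<in>S. 0 \<le> x p + e * w p" by auto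
  \<comment> \<open>The summand \<open>1\<close> keeps the denominator positive when
    \<open>w q = 0\<close>; the quotient ensures
    \<open>d * \<bar>w q\<bar> \<le> x q\<close>.\<close>
  define d where "d = min e (x q / (\<bar>w q\<bar> + 1))"
  have xq: "0 < x q" using insert by auto
  have d: "0 < d" "d \<le> e" using e xq by (auto simp: d_def)
  have "d * \<bar>w q\<bar> \<le> x q / (\<bar>w q\<bar> + 1) * (\<bar>w q\<bar> + 1)"
    by (intro mult_mono) (use xq in \<open>auto simp: d_def\<close>)
  then have "d * \<bar>w q\<bar> \<le> x q" by simp
  moreover have "- (d * \<bar>w q\<bar>) \<le> d * w q"
    using d by (metis abs_ge_minus_self abs_mult abs_of_pos minus_le_iff)
  ultimately have "0 \<le> x q + d * w q" by linarith
  \<comment> \<open>Shrinking the step from \<open>e\<close> to \<open>d\<close> preserves the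
    earlier constraints: a nonnegative \<open>w p\<close> is harmless, and a negative one now does
    less damage.\<close>
  moreover have "0 \<le> x p + d * w p" if "p \<in> S" for p
  proof (cases "w p \<ge> 0")
    case True
    then show ?thesis using d insert.prems[of p] that by (simp add: less_imp_le)
  next
    case False
    then have "e * w p \<le> d * w p" using d by (intro mult_right_mono_neg) auto
    then show ?thesis using e that by fastforce
  qed
  ultimately show ?case using d by auto
qed

text \<open>Here \<open>z\<close> measures pool capacity, and the factor \<open>m i\<close> converts
  it to a service rate. Within a row this factor is constant, so arrival totals are kept; in a
  column, division by \<open>mu\<close> removes it, so loads are kept too.\<close>

lemma spp_unique_imp_null_flow_zero:
  assumes opt: "spp_optimal I J lam bet mu x rho"
    and uniq: "\<And>x' rho'. spp_optimal I J lam bet mu x' rho' \<Longrightarrow> x' = x"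
    and m: "\<And>i. i < I \<Longrightarrow> 0 < m i"
      "\<And>i j. (i, j) \<in> basic_activities x \<Longrightarrow> mu $$ (i, j) = m i"
    and z: "\<And>i j. i < I \<Longrightarrow> j < J \<Longrightarrow> (i, j) \<notin> basic_activities x \<Longrightarrow> z i j = 0"
      "\<And>i. i < I \<Longrightarrow> (\<Sum>j<J. z i j) = 0" "\<And>j. j < J \<Longrightarrow> (\<Sum>i<I. z i j) = 0"
    and ij: "i < I" "j < J"
  shows "z i j = (0::real)"
proof -
  let ?E = "basic_activities x"
  have feas: "spp_feasible I J lam bet mu x rho" using opt unfolding spp_optimal_def by simp
  then have xc: "x \<in> carrier_mat I J" and x0: "\<forall>i<I. \<forall>j<J. 0 \<le> x $$ (i, j)"
    and xmu: "\<forall>i<I. \<forall>j<J. mu $$ (i, j) = 0 \<longrightarrow> x $$ (i, j) = 0"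
    and xr: "\<forall>i<I. (\<Sum>j<J. x $$ (i, j)) = lam $ i"
    and xs: "\<forall>j<J. (\<Sum>i<I. x $$ (i, j) / (bet $ j * mu $$ (i, j))) \<le> rho"
    unfolding spp_feasible_def by auto
  have inE: "(i, j) \<in> ?E \<longleftrightarrow> 0 < x $$ (i, j)" if "i < I" "j < J" for i j
    using that xc unfolding basic_activities_def by auto
  have Esub: "?E \<subseteq> {..<I} \<times> {..<J}" using xc unfolding basic_activities_def by auto
  have "finite ?E" by (rule finite_subset[OF Esub]) simp
  then have "\<exists>e>0. \<forall>p\<in>?E. 0 \<le> x $$ p + e * (m (fst p) * z (fst p) (snd p))"
    by (rule ex_positive_perturbation) (auto simp: basic_activities_def)
  then obtain e where e: "e > 0"
    "\<forall>p\<in>?E. 0 \<le> x $$ p + e * (m (fst p) * z (fst p) (snd p))" by blast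
  define x' where "x' = mat I J (\<lambda>(i, j). x $$ (i, j) + e * (m i * z i j))"
  have x'[simp]: "x' $$ (i, j) = x $$ (i, j) + e * (m i * z i j)" if "i < I" "j < J" for i j
    using that unfolding x'_def by simp
  have pos: "0 \<le> x' $$ (i, j)" if "i < I" "j < J" for i j
  proof (cases "(i, j) \<in> ?E")
    case True
    then show ?thesis using e(2) that by fastforce
  next
    case False
    then show ?thesis using z(1)[OF that False] x0 that by simp
  qed
  \<comment> \<open>Where \<open>mu\<close> vanishes, feasibility gives \<open>x = 0\<close>, so the
    activity is not basic and \<open>z\<close> vanishes there as well.\<close>
  have mu0: "x' $$ (i, j) = 0" if "i < I" "j < J" "mu $$ (i, j) = 0" for i j
  proof -
    have "x $$ (i, j) = 0" using xmu that by blast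
    then show ?thesis using z(1)[OF that(1,2)] inE[OF that(1,2)] that by simp
  qed
  have rows: "(\<Sum>j<J. x' $$ (i, j)) = lam $ i" if "i < I" for i
  proof -
    have "(\<Sum>j<J. x' $$ (i, j)) = (\<Sum>j<J. x $$ (i, j)) + e * (m i * (\<Sum>j<J. z i j))"
      using that by (simp add: sum.distrib sum_distrib_left)
    then show ?thesis using z(2) xr that by simp
  qed
  have cols: "(\<Sum>i<I. x' $$ (i, j) / (bet $ j * mu $$ (i, j))) \<le> rho" if "j < J" for j
  proof -
    have "x' $$ (i, j) / (bet $ j * mu $$ (i, j))
        = x $$ (i, j) / (bet $ j * mu $$ (i, j)) + e / bet $ j * z i j" if i: "i < I" for i
    proof (cases "(i, j) \<in> ?E")
      case True
      then have "mu $$ (i, j) = m i" by (rule m(2))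
      then show ?thesis using m(1)[OF i] i \<open>j < J\<close> by (simp add: add_divide_distrib)
    next
      case False
      then show ?thesis using z(1)[OF i \<open>j < J\<close> False] i \<open>j < J\<close> by simp
    qed
    then have "(\<Sum>i<I. x' $$ (i, j) / (bet $ j * mu $$ (i, j)))
      = (\<Sum>i<I. x $$ (i, j) / (bet $ j * mu $$ (i, j))) + e / bet $ j * (\<Sum>i<I. z i j)"
      by (simp add: sum.distrib sum_distrib_left)
    then show ?thesis using z(3) xs that by simp
  qed
  have "spp_feasible I J lam bet mu x' rho"
    unfolding spp_feasible_def using pos mu0 rows cols by (auto simp: x'_def)
  \<comment> \<open>Feasibility with the same \<open>rho\<close> suffices: the minimality clause of
    \<open>spp_optimal\<close> concerns \<open>rho\<close> alone.\<close>
  then have "spp_optimal I J lam bet mu x' rho" using opt unfolding spp_optimal_def by blast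
  then have "x' $$ (i, j) = x $$ (i, j)" using uniq by blast
  then show ?thesis using ij e(1) m(1)[of i] by simp
qed

text \<open>The description by \<open>THE\<close> yields equations only once existence and
  uniqueness are known. The row equation is the consequence that determines
  \<open>A_u\<close>.\<close>

lemma M_map_row_sum:
  assumes params: "model_parameters I J lam bet mu"
    and crp: "complete_resource_pooling I J lam bet mu x rho"
    and m: "\<And>i. i < I \<Longrightarrow> 0 < m i"
      "\<And>i j. (i, j) \<in> basic_activities x \<Longrightarrow> mu $$ (i, j) = m i"
    and i: "i < I"
  shows "(\<Sum>j\<in>pools_of (basic_activities x) i. M_map I J bet (basic_activities x) y $$ (i, j)) = y $ i"
proof -
  let ?E = "basic_activities x"
  let ?eta = "(\<Sum>i<I. y $ i) / (\<Sum>j<J. bet $ j)"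
  let ?P = "\<lambda>z. z \<in> carrier_mat I J \<and>
     (\<forall>i<I. \<forall>j<J. (i, j) \<notin> ?E \<longrightarrow> z $$ (i, j) = 0) \<and>
     (\<forall>j<J. (\<Sum>i\<in>types_of ?E j. z $$ (i, j)) = ?eta * bet $ j) \<and>
     (\<forall>i<I. (\<Sum>j\<in>pools_of ?E i. z $$ (i, j)) = y $ i)"
  have opt: "spp_optimal I J lam bet mu x rho"
    and uniq: "\<And>x' rho'. spp_optimal I J lam bet mu x' rho' \<Longrightarrow> x' = x"
    and tree: "is_tree (activity_vertices I J) (activity_edges ?E)"
    using crp unfolding complete_resource_pooling_def by blast+
  have "x \<in> carrier_mat I J" using opt unfolding spp_optimal_def spp_feasible_def by simp
  then have E: "?E \<subseteq> {..<I} \<times> {..<J}" unfolding basic_activities_def by auto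
  have J: "1 \<le> J" and bet: "\<And>j. j < J \<Longrightarrow> 0 < bet $ j"
    using params unfolding model_parameters_def by auto
  \<comment> \<open>Positive total capacity makes \<open>?eta\<close> a genuine quotient, whence row
    targets and column targets have equal totals.\<close>
  have "0 < (\<Sum>j<J. bet $ j)" by (rule sum_pos) (use J bet in \<open>auto simp: lessThan_empty_iff\<close>)
  then have "?eta * (\<Sum>j<J. bet $ j) = (\<Sum>i<I. y $ i)" by simp
  then have bal: "(\<Sum>i<I. y $ i) = (\<Sum>j<J. ?eta * bet $ j)" by (simp only: sum_distrib_left)
  define b where "b v = (case v of Inl i \<Rightarrow> y $ i | Inr j \<Rightarrow> ?eta * bet $ j)" for v
  have r: "Inl i \<in> activity_vertices I J" using i unfolding activity_vertices_def by auto
  have "sums_solvable I J ?E b"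
  proof (rule sums_solvable_balanced[OF E r])
    show "(u, Inl i) \<in> {(a, b). {a, b} \<in> activity_edges ?E}\<^sup>*"
      if "u \<in> activity_vertices I J" for u
      using tree r that unfolding is_tree_def by blast
    show "(\<Sum>i<I. b (Inl i)) = (\<Sum>j<J. b (Inr j))"
      using bal by (simp only: b_def sum.case)
  qed
  then obtain f where f: "\<forall>i j. (i, j) \<notin> ?E \<longrightarrow> f i j = 0"
    "\<forall>i<I. (\<Sum>j<J. f i j) = y $ i" "\<forall>j<J. (\<Sum>i<I. f i j) = ?eta * bet $ j"
    unfolding sums_solvable_def b_def sum.case by blast
  have P_iff: "?P z \<longleftrightarrow> z \<in> carrier_mat I J \<and>
     (\<forall>i<I. \<forall>j<J. (i, j) \<notin> ?E \<longrightarrow> z $$ (i, j) = 0) \<and>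
     (\<forall>j<J. (\<Sum>i<I. z $$ (i, j)) = ?eta * bet $ j) \<and>
     (\<forall>i<I. (\<Sum>j<J. z $$ (i, j)) = y $ i)" for z
    using sum_types_of[OF E, of "\<lambda>i j. z $$ (i, j)"] sum_pools_of[OF E, of "\<lambda>i j. z $$ (i, j)"]
    by auto
  have "\<exists>!z. ?P z"
  proof (rule ex_ex1I)
    show "\<exists>z. ?P z"
      unfolding P_iff by (rule exI[of _ "mat I J (\<lambda>(i, j). f i j)"]) (use f in auto)
  next
    fix z w assume P: "?P z" "?P w"
    from P(1) have z: "z \<in> carrier_mat I J" "\<forall>i<I. \<forall>j<J. (i, j) \<notin> ?E \<longrightarrow> z $$ (i, j) = 0"
      "\<forall>j<J. (\<Sum>i<I. z $$ (i, j)) = ?eta * bet $ j" "\<forall>i<I. (\<Sum>j<J. z $$ (i, j)) = y $ i"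
      unfolding P_iff by - (elim conjE, assumption)+
    from P(2) have w: "w \<in> carrier_mat I J" "\<forall>i<I. \<forall>j<J. (i, j) \<notin> ?E \<longrightarrow> w $$ (i, j) = 0"
      "\<forall>j<J. (\<Sum>i<I. w $$ (i, j)) = ?eta * bet $ j" "\<forall>i<I. (\<Sum>j<J. w $$ (i, j)) = y $ i"
      unfolding P_iff by - (elim conjE, assumption)+
    \<comment> \<open>The difference of two solutions is supported on basic activities and has zero
      row and column sums.\<close>
    have off: "z $$ (i, j) - w $$ (i, j) = 0" if "i < I" "j < J" "(i, j) \<notin> ?E" for i j
      using z(2) w(2) that by simp
    have rows: "(\<Sum>j<J. z $$ (i, j) - w $$ (i, j)) = 0" if "i < I" for i
      using z(4) w(4) that by (simp add: sum_subtractf)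
    have cols: "(\<Sum>i<I. z $$ (i, j) - w $$ (i, j)) = 0" if "j < J" for j
      using z(3) w(3) that by (simp add: sum_subtractf)
    have "z $$ (i, j) - w $$ (i, j) = 0" if "i < I" "j < J" for i j
      using spp_unique_imp_null_flow_zero
        [of I J lam bet mu x rho m "\<lambda>i j. z $$ (i, j) - w $$ (i, j)",
         OF opt uniq m off rows cols that] .
    then show "z = w" using z(1) w(1) by (intro eq_matI) auto
  qed
  then have "?P (M_map I J bet ?E y)" unfolding M_map_def by (rule theI')
  then show ?thesis using i by blast
qed

text \<open>Column \<open>k\<close> of \<open>A_u\<close> has the single nonzero entry
  \<open>- m k\<close>, so subtracting its mean adds \<open>m k / I\<close> to every entry.\<close>

lemma A_c_eq:
  assumes params: "model_parameters I J lam bet mu"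
    and crp: "complete_resource_pooling I J lam bet mu x rho"
    and m: "\<And>i. i < I \<Longrightarrow> 0 < m i"
      "\<And>i j. (i, j) \<in> basic_activities x \<Longrightarrow> mu $$ (i, j) = m i"
  shows "A_c I J bet mu (basic_activities x) =
    mat I I (\<lambda>(i, k). m k / real I - (if i = k then m k else 0))"
proof -
  let ?E = "basic_activities x"
  have map: "A_u_map I J bet mu ?E y $ i = - (m i * y $ i)" if "i < I" for y i
  proof -
    have "(\<Sum>j\<in>pools_of ?E i. mu $$ (i, j) * M_map I J bet ?E y $$ (i, j))
      = m i * (\<Sum>j\<in>pools_of ?E i. M_map I J bet ?E y $$ (i, j))"
      unfolding sum_distrib_left by (intro sum.cong refl) (simp add: pools_of_def m(2))
    then show ?thesis
      using that M_map_row_sum[OF params crp m that] by (simp add: A_u_map_def)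
  qed
  have A_u: "A_u I J bet mu ?E $$ (i, k) = (if i = k then - m k else 0)"
    if "i < I" "k < I" for i k
    using that by (simp add: A_u_def map unit_vec_def)
  show ?thesis
    unfolding A_c_def by (rule eq_matI) (auto simp: A_u)
qed

section \<open>Simplicity of the eigenvalue zero and signs of the other eigenvalues\<close>

text \<open>
  Adding all rows of \<open>X - B\<close> to the first one turns that row into \<open>X (1, \<dots>, 1)\<close>. Dividing it by
  \<open>X\<close> leaves a matrix whose kernel at \<open>X = 0\<close> consists of the zero-sum vectors in the kernel of
  \<open>B\<close>.
\<close>

lemma order_zero_char_poly_eq_1:
  fixes B :: "'a :: field mat"
  assumes B: "B \<in> carrier_mat n n" and n: "0 < n"
    and colsum: "\<And>k. k < n \<Longrightarrow> (\<Sum>i<n. B $$ (i, k)) = 0"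
    and ker: "\<And>v. v \<in> carrier_vec n \<Longrightarrow> B *\<^sub>v v = 0\<^sub>v n \<Longrightarrow> (\<Sum>i<n. v $ i) = 0 \<Longrightarrow> v = 0\<^sub>v n"
  shows "order 0 (char_poly B) = 1"
proof -
  define C where "C = char_poly_matrix B"
  \<comment> \<open>\<open>T\<close> adds all rows to the first one and has determinant
    \<open>1\<close>; \<open>D\<close> carries the factor \<open>[:0, 1:]\<close>, that is
    \<open>X\<close>, extracted from that row; \<open>N\<close> is what remains.\<close>
  define T where "T = mat n n (\<lambda>(i, j). if i = 0 \<or> i = j then 1 else (0 :: 'a poly))"
  define D where
    "D = mat n n (\<lambda>(i, j). if i = j then (if i = 0 then [:0, 1:] else 1) else (0 :: 'a poly))"
  define N where "N = mat n n (\<lambda>(i, j). if i = 0 then 1 else C $$ (i, j))"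
  have C: "C \<in> carrier_mat n n" using B unfolding C_def by simp
  have Cij: "C $$ (i, j) = (if i = j then [:0, 1:] else 0) - [:B $$ (i, j):]"
    if "i < n" "j < n" for i j
    using that B unfolding C_def char_poly_matrix_def by auto
  have carr: "T \<in> carrier_mat n n" "D \<in> carrier_mat n n" "N \<in> carrier_mat n n"
    unfolding T_def D_def N_def by auto
  have "prod_list (diag_mat T) = 1"
    unfolding prod_list_diag_prod by (rule prod.neutral) (simp add: T_def)
  moreover have "upper_triangular T" unfolding T_def by auto
  ultimately have detT: "det T = 1" using det_upper_triangular[OF _ carr(1)] by simp
  have "prod_list (diag_mat D) = (\<Prod>i<n. if i = 0 then [:0, 1:] else 1)"
    unfolding prod_list_diag_prod by (rule prod.cong) (auto simp: D_def)
  also have "\<dots> = [:0, 1:]" using n by (subst prod.delta) auto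
  finally have "prod_list (diag_mat D) = [:0, 1:]" .
  moreover have "upper_triangular D" unfolding D_def by auto
  ultimately have detD: "det D = [:0, 1:]" using det_upper_triangular[OF _ carr(2)] by simp
  have Csum: "(\<Sum>i<n. C $$ (i, j)) = [:0, 1:]" if "j < n" for j
  proof -
    have "(\<Sum>i<n. C $$ (i, j)) = (\<Sum>i<n. if i = j then [:0, 1:] else 0) - (\<Sum>i<n. [:B $$ (i, j):])"
      using that by (simp add: Cij sum_subtractf)
    also have "(\<Sum>i<n. [:B $$ (i, j):]) = [:\<Sum>i<n. B $$ (i, j):]"
      by (induction n) auto
    finally show ?thesis using that colsum by simp
  qed
  have "T * C = D * N"
  proof (rule eq_matI)
    fix i j assume "i < dim_row (D * N)" "j < dim_col (D * N)"
    then have ij: "i < n" "j < n" using carr by auto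
    have "(T * C) $$ (i, j) = (\<Sum>k<n. (if i = 0 \<or> i = k then 1 else 0) * C $$ (k, j))"
      using ij carr C by (simp add: T_def scalar_prod_def lessThan_atLeast0)
    also have "\<dots> = (if i = 0 then [:0, 1:] else C $$ (i, j))"
      using ij Csum by (simp add: if_distrib[of "\<lambda>t. t * _"] cong: if_cong)
    also have "\<dots> = (\<Sum>k<n. (if i = k then (if i = 0 then [:0, 1:] else 1) else 0) * N $$ (k, j))"
      using ij by (simp add: if_distrib[of "\<lambda>t. t * _"] N_def cong: if_cong)
    also have "\<dots> = (D * N) $$ (i, j)"
      using ij carr by (simp add: D_def scalar_prod_def lessThan_atLeast0)
    finally show "(T * C) $$ (i, j) = (D * N) $$ (i, j)" .
  qed (use carr C in auto)
  then have "det T * det C = det D * det N"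
    using det_mult[OF carr(1) C] det_mult[OF carr(2,3)] by simp
  then have cp: "char_poly B = [:0, 1:] * det N"
    by (simp add: detT detD char_poly_def C_def)
  \<comment> \<open>The value of \<open>N\<close> at \<open>X = 0\<close>. Its determinant decides
    whether \<open>0\<close> is a root of the cofactor \<open>det N\<close>.\<close>
  define N0 where "N0 = mat n n (\<lambda>(i, j). if i = 0 then 1 else - B $$ (i, j))"
  have N0: "N0 \<in> carrier_mat n n" unfolding N0_def by auto
  have "map_mat (\<lambda>p. poly p 0) N = N0"
    by (rule eq_matI) (auto simp: N_def N0_def Cij)
  moreover have "comm_ring_hom (\<lambda>p :: 'a poly. poly p 0)" by unfold_locales auto
  ultimately have ev_det: "poly (det N) 0 = det N0" using comm_ring_hom.hom_det by metis
  have "det N0 \<noteq> 0"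
  proof
    assume "det N0 = 0"
    then obtain v where v: "v \<in> carrier_vec n" "v \<noteq> 0\<^sub>v n" "N0 *\<^sub>v v = 0\<^sub>v n"
      using det_0_iff_vec_prod_zero[OF N0] by blast
    have N0v: "(\<Sum>k<n. N0 $$ (i, k) * v $ k) = 0" if "i < n" for i
      using arg_cong[OF v(3), of "\<lambda>u. u $ i"] that N0 v(1)
      by (simp add: scalar_prod_def lessThan_atLeast0)
    have Bv: "(B *\<^sub>v v) $ i = (\<Sum>k<n. B $$ (i, k) * v $ k)" if "i < n" for i
      using that B v(1) by (simp add: scalar_prod_def lessThan_atLeast0)
    have sum0: "(\<Sum>k<n. v $ k) = 0" using N0v[OF n] n by (simp add: N0_def)
    have pos: "(B *\<^sub>v v) $ i = 0" if "i < n" "i \<noteq> 0" for i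
      using N0v[OF that(1)] that by (simp add: N0_def Bv sum_negf)
    \<comment> \<open>Row \<open>0\<close> of \<open>B\<close> was overwritten by ones in
      \<open>N0\<close>. Its equation is recovered from the others, since zero column sums make the
      entries of \<open>B v\<close> add up to zero.\<close>
    have "(\<Sum>i<n. (B *\<^sub>v v) $ i) = (\<Sum>i<n. \<Sum>k<n. B $$ (i, k) * v $ k)"
      by (simp add: Bv)
    also have "\<dots> = (\<Sum>k<n. (\<Sum>i<n. B $$ (i, k)) * v $ k)"
      unfolding sum_distrib_right by (rule sum.swap)
    also have "\<dots> = 0" by (simp add: colsum)
    also have "(\<Sum>i<n. (B *\<^sub>v v) $ i) = (\<Sum>i<n. if i = 0 then (B *\<^sub>v v) $ 0 else 0)"
      by (rule sum.cong) (use pos in auto)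
    finally have "(B *\<^sub>v v) $ 0 = 0" using n by simp
    with pos have "B *\<^sub>v v = 0\<^sub>v n" using B by (intro eq_vecI) auto
    with ker v sum0 show False by blast
  qed
  then have nz: "poly (det N) 0 \<noteq> 0" using ev_det by simp
  then have "det N \<noteq> 0" by auto
  then have "order 0 (char_poly B) = order 0 [:0, 1 :: 'a:] + order 0 (det N)"
    unfolding cp by (subst order_mult) simp_all
  moreover have "order 0 (det N) = 0" using nz by (simp add: order_0I)
  moreover have "order 0 [:0, 1 :: 'a:] = 1"
    using order_power_n_n[of "0::'a" 1] by simp
  ultimately show ?thesis by simp
qed

lemma critically_stable_projected_diagonal:
  fixes m :: "nat \<Rightarrow> real"
  assumes n: "0 < n" and m: "\<And>i. i < n \<Longrightarrow> 0 < m i"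
  shows "critically_stable (mat n n (\<lambda>(i, k). m k / real n - (if i = k then m k else 0)))"
    (is "critically_stable ?A")
proof -
  define B where "B = map_mat complex_of_real ?A"
  \<comment> \<open>The mean of the entries of \<open>D v\<close>; the matrix acts by
    \<open>v\<close> \<mapsto> \<open>s v - m i * v $ i\<close> in coordinate
    \<open>i\<close>.\<close>
  define s where "s v = (\<Sum>k<n. of_real (m k) * v $ k) / of_nat n" for v :: "complex vec"
  have B: "B \<in> carrier_mat n n" unfolding B_def by simp
  have Bij: "B $$ (i, k) = of_real (m k) / of_nat n - (if i = k then of_real (m k) else 0)"
    if "i < n" "k < n" for i k
    using that unfolding B_def by simp
  have Bv: "(B *\<^sub>v v) $ i = s v - of_real (m i) * v $ i" if "i < n" "v \<in> carrier_vec n" for v i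
  proof -
    have "(B *\<^sub>v v) $ i = (\<Sum>k<n. B $$ (i, k) * v $ k)"
      using that B by (simp add: scalar_prod_def lessThan_atLeast0)
    also have "\<dots> = (\<Sum>k<n. of_real (m k) * v $ k / of_nat n
        - (if i = k then of_real (m k) * v $ k else 0))"
      by (rule sum.cong) (use that in \<open>auto simp: Bij algebra_simps\<close>)
    also have "\<dots> = s v - of_real (m i) * v $ i"
      using that by (simp add: sum_subtractf s_def sum_divide_distrib)
    finally show ?thesis .
  qed
  have colsum: "(\<Sum>i<n. B $$ (i, k)) = 0" if "k < n" for k
    using that n by (simp add: Bij sum_subtractf)
  have ker: "v = 0\<^sub>v n"
    if v: "v \<in> carrier_vec n" "B *\<^sub>v v = 0\<^sub>v n" "(\<Sum>i<n. v $ i) = 0" for v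
  proof -
    have vi: "v $ i = s v * of_real (1 / m i)" if "i < n" for i
      using Bv[OF that v(1)] v(2) that m[OF that] by (simp add: field_simps)
    \<comment> \<open>Kernel vectors are multiples of the reciprocals of \<open>m\<close>, whose sum
      is positive, so zero sum forces the factor \<open>s v\<close> to vanish.\<close>
    have "(\<Sum>i<n. v $ i) = s v * of_real (\<Sum>i<n. 1 / m i)"
      unfolding of_real_sum sum_distrib_left by (rule sum.cong) (use vi in auto)
    moreover have "0 < (\<Sum>i<n. 1 / m i)"
      by (rule sum_pos) (use n m in \<open>auto simp: lessThan_empty_iff\<close>)
    ultimately have "s v = 0" using v(3) by (metis less_irrefl mult_eq_0_iff of_real_eq_0_iff)
    then show ?thesis using vi v(1) by (intro eq_vecI) auto
  qed
  have ev0: "eigenvalue B 0"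
  proof -
    define v where "v = vec n (\<lambda>i. complex_of_real (1 / m i))"
    have v: "v \<in> carrier_vec n" unfolding v_def by simp
    have mv: "of_real (m i) * v $ i = 1" if "i < n" for i
      using that m[OF that] unfolding v_def by simp
    have "s v = 1" using n by (simp add: s_def mv)
    then have "B *\<^sub>v v = 0 \<cdot>\<^sub>v v" using B v Bv mv by (intro eq_vecI) auto
    moreover have "v \<noteq> 0\<^sub>v n"
    proof
      assume "v = 0\<^sub>v n"
      then show False using mv[OF n] n by simp
    qed
    ultimately show ?thesis using B v unfolding eigenvalue_def eigenvector_def by auto
  qed
  have neg: "Re z < 0" if ez: "eigenvalue B z" and z: "z \<noteq> 0" for z
  proof -
    obtain v where v: "v \<in> carrier_vec n" "v \<noteq> 0\<^sub>v n" "B *\<^sub>v v = z \<cdot>\<^sub>v v"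
      using ez B unfolding eigenvalue_def eigenvector_def by auto
    have zv: "z * v $ i = s v - of_real (m i) * v $ i" if "i < n" for i
      using Bv[OF that v(1)] v(1,3) that by simp
    \<comment> \<open>Summing the eigenvalue equation kills the right side because
      \<open>s v\<close> is a mean; \<open>z \<noteq> 0\<close> then gives zero sum.\<close>
    have "z * (\<Sum>i<n. v $ i) = (\<Sum>i<n. s v - of_real (m i) * v $ i)"
      unfolding sum_distrib_left by (rule sum.cong) (use zv in auto)
    also have "\<dots> = 0" using n by (simp add: sum_subtractf s_def)
    finally have sum0: "(\<Sum>i<n. v $ i) = 0" using z by simp
    have norm: "v $ i * cnj (v $ i) = of_real ((cmod (v $ i))\<^sup>2)" for i
      by (simp only: complex_norm_square)
    let ?Q = "\<Sum>i<n. (cmod (v $ i))\<^sup>2"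
    let ?R = "\<Sum>i<n. m i * (cmod (v $ i))\<^sup>2"
    have "z * of_real ?Q = (\<Sum>i<n. (z * v $ i) * cnj (v $ i))"
      by (simp add: sum_distrib_left norm mult.assoc)
    also have "\<dots> = (\<Sum>i<n. s v * cnj (v $ i) - of_real (m i * (cmod (v $ i))\<^sup>2))"
    proof (rule sum.cong)
      fix i assume "i \<in> {..<n}"
      then have "z * v $ i * cnj (v $ i) = s v * cnj (v $ i) - of_real (m i) * (v $ i * cnj (v $ i))"
        by (simp add: zv algebra_simps)
      then show "z * v $ i * cnj (v $ i) = s v * cnj (v $ i) - of_real (m i * (cmod (v $ i))\<^sup>2)"
        by (simp only: norm of_real_mult)
    qed simp
    \<comment> \<open>The term \<open>s v\<close> does not depend on \<open>i\<close>, so zero sum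
      removes it from the pairing and a real quantity is left.\<close>
    also have "\<dots> = s v * cnj (\<Sum>i<n. v $ i) - of_real ?R"
      by (simp add: sum_subtractf sum_distrib_left)
    also have "\<dots> = - of_real ?R" by (simp add: sum0)
    finally have "Re (z * of_real ?Q) = Re (- of_real ?R)" by (rule arg_cong)
    then have eq: "Re z * ?Q = - ?R" by simp
    obtain k where k: "k < n" "v $ k \<noteq> 0"
      using v(1,2) by (metis carrier_vecD eq_vecI index_zero_vec(1,2))
    have "0 < ?R"
      by (rule sum_pos2[of _ k]) (use k m in \<open>auto simp: less_imp_le\<close>)
    then have "Re z * ?Q < 0" using eq by simp
    moreover have "0 \<le> ?Q" by (simp add: sum_nonneg)
    ultimately show ?thesis by (simp add: mult_less_0_iff)
  qed
  show ?thesis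
    unfolding critically_stable_def Let_def B_def[symmetric]
    using ev0 neg order_zero_char_poly_eq_1[OF B n colsum ker] by blast
qed

theorem theorem4p3:
  fixes I J :: nat and lam bet :: "real vec" and mu x :: "real mat" and rho :: real
  assumes "model_parameters I J lam bet mu"
    and "complete_resource_pooling I J lam bet mu x rho"
    and "rho = 1"
    and "\<exists>m :: nat \<Rightarrow> real. (\<forall>i<I. 0 < m i) \<and>
           (\<forall>(i, j) \<in> basic_activities x. mu $$ (i, j) = m i)"
  shows "critically_stable (A_c I J bet mu (basic_activities x))"
proof -
  obtain m :: "nat \<Rightarrow> real" where m: "\<And>i. i < I \<Longrightarrow> 0 < m i"
    "\<And>i j. (i, j) \<in> basic_activities x \<Longrightarrow> mu $$ (i, j) = m i"
    using assms(4) by blast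
  have "0 < I" using assms(1) unfolding model_parameters_def by simp
  from critically_stable_projected_diagonal[of I m, OF this m(1)] show ?thesis
    by (simp only: A_c_eq[of I J lam bet mu x rho m, OF assms(1,2) m])
qed

end
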